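(* There exists a constant $C>0$ such that for every integer $d\ge5$ there exists a finite set $X\subset\mathbb{R}^d$ with $|X|\le C d^4$ that is an equi-weighted Gaussian $5$-design, i.e. \[ \frac{1}{|X|}\sum_{x\in X}f(x)=\frac{1}{\pi^{d/2}}\int_{\mathbb{R}^d}f(\omega)\,e^{-\sum_{i=1}^d\omega_i^2}\,d\omega_1\cdots d\omega_d\quad\text{for all } f\in\mathbb{R}_5[x_1,\ldots,x_d]. \]
   Context: $\mathbb{R}_5[x_1,\ldots,x_d]$ denotes the space of real polynomials in $d$ variables of total degree at most $5$. *)

theory Defs
  imports "HOL-Analysis.Analysis"
begin

text \<open>Since the dimension \<open>d\<close> is quantified inside the statement (after the constant), the space
  \<open>\<real>\<^sup>d\<close> is represented by the extensional functions on \<open>{..<d}\<close>, so that distinct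
  points are distinct functions.\<close>

definition Rd :: "nat \<Rightarrow> (nat \<Rightarrow> real) set" where
  "Rd d = ({..<d} \<rightarrow>\<^sub>E UNIV)"

definition lebesgue_Rd :: "nat \<Rightarrow> (nat \<Rightarrow> real) measure" where
  "lebesgue_Rd d = Pi\<^sub>M {..<d} (\<lambda>_. lborel)"

lemma space_lebesgue_Rd: "space (lebesgue_Rd d) = Rd d"
  by (simp add: lebesgue_Rd_def Rd_def space_PiM)

definition exponents_le :: "nat \<Rightarrow> nat \<Rightarrow> (nat \<Rightarrow> nat) set" where
  "exponents_le k d = {\<alpha> \<in> {..<d} \<rightarrow>\<^sub>E UNIV. (\<Sum>i<d. \<alpha> i) \<le> k}"

lemma finite_exponents_le: "finite (exponents_le k d)"
proof (rule finite_subset)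
  show "exponents_le k d \<subseteq> ({..<d} \<rightarrow>\<^sub>E {..k})"
  proof
    fix \<alpha> assume a: "\<alpha> \<in> exponents_le k d"
    have "\<alpha> i \<le> k" if "i < d" for i
    proof -
      have "\<alpha> i \<le> (\<Sum>i<d. \<alpha> i)"
        using that by (intro member_le_sum) auto
      also have "\<dots> \<le> k"
        using a by (simp add: exponents_le_def)
      finally show ?thesis .
    qed
    with a show "\<alpha> \<in> ({..<d} \<rightarrow>\<^sub>E {..k})"
      by (auto simp: exponents_le_def PiE_iff)
  qed
  show "finite ({..<d} \<rightarrow>\<^sub>E {..k})"
    by (intro finite_PiE) auto
qed

text \<open>Real polynomials in \<open>d\<close> variables of total degree at most \<open>k\<close>, as polynomial functions;
  over the infinite field \<open>\<real>\<close> these correspond bijectively to formal polynomials.\<close>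

definition polys_le :: "nat \<Rightarrow> nat \<Rightarrow> ((nat \<Rightarrow> real) \<Rightarrow> real) set" where
  "polys_le k d =
     {f. \<exists>c :: (nat \<Rightarrow> nat) \<Rightarrow> real.
           f = (\<lambda>x. \<Sum>\<alpha>\<in>exponents_le k d. c \<alpha> * (\<Prod>i<d. x i ^ \<alpha> i))}"

definition equi_weighted_gaussian_design :: "nat \<Rightarrow> nat \<Rightarrow> (nat \<Rightarrow> real) set \<Rightarrow> bool" where
  "equi_weighted_gaussian_design t d X \<longleftrightarrow>
     finite X \<and> X \<noteq> {} \<and> X \<subseteq> Rd d \<and>
     (\<forall>f \<in> polys_le t d.
        1 / real (card X) * (\<Sum>x\<in>X. f x) =
        1 / pi powr (real d / 2) *
          (LINT \<omega>|lebesgue_Rd d. f \<omega> * exp (- (\<Sum>i<d. (\<omega> i)\<^sup>2))))"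

end

theory Submission
  imports Defs "HOL-Probability.Distributions"
begin

text \<open>
  The design is a product of signs and radii: its points are \<open>(\<sigma> i * sqrt (y i))\<^sub>i\<close>, where
  \<open>\<sigma>\<close> runs over a group of sign vectors and \<open>y\<close> over \<open>d + 1\<close> positive vectors.

  The sign vectors form a binary linear code, closed under negation, whose dual has no nonzero word
  of weight at most 5. Choosing the columns of a generator matrix greedily (Gilbert--Varshamov)
  yields such a code with \<open>O(d\<^sup>3)\<close> elements. It kills every monomial of degree at most 5
  having some odd exponent.

  For the remaining monomials only the first and second moments of \<open>y\<close> matter, so a regular simplex
  of \<open>d + 1\<close> points in \<open>\<real>\<^sup>d\<close> with the right centre and size is enough. For \<open>d \<ge> 5\<close> it
  can be rotated so that all its vertices have positive coordinates, and positivity makes the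
  points of the product distinct.
\<close>

section \<open>Gaussian moments\<close>

text \<open>Moments of the normal law with mean 0 and variance 1/2, whose density is
  \<open>exp (- x\<^sup>2) / sqrt pi\<close>. For even \<open>k\<close> the quotient is the double
  factorial of \<open>k - 1\<close> divided by \<open>2 ^ (k div 2)\<close>.\<close>

definition gauss_moment :: "nat \<Rightarrow> real" where
  "gauss_moment k = (if even k then fact k / (2 ^ k * fact (k div 2)) else 0)"

lemma gauss_moment_simps [simp]:
  "gauss_moment 0 = 1" "gauss_moment 2 = 1 / 2" "gauss_moment 4 = 3 / 4"
  by (simp_all add: gauss_moment_def fact_numeral)

text \<open>The moments over the half-line are known; the parity of the integrand either doubles
  them or cancels them.\<close>

lemma has_bochner_integral_gauss_moment:
  "has_bochner_integral lborel (\<lambda>x::real. x ^ k * exp (- x\<^sup>2)) (sqrt pi * gauss_moment k)"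
proof (cases "even k")
  case True
  then obtain m where m: "k = 2 * m" by (elim evenE)
  show ?thesis
    using has_bochner_integral_even_function[OF gaussian_moment_even_pos[of m]]
    by (simp add: m gauss_moment_def mult.commute)
next
  case False
  then obtain m where m: "k = 2 * m + 1" by (elim oddE)
  have "has_bochner_integral lborel (\<lambda>x::real. exp (- x\<^sup>2) * x ^ (2 * m + 1)) 0"
    using gaussian_moment_odd_pos by (rule has_bochner_integral_odd_function) simp
  then show ?thesis
    using False unfolding m by (simp add: gauss_moment_def mult.commute)
qed

text \<open>The integrand is a product of functions of one coordinate each, so Fubini reduces it to
  one-dimensional moments.\<close>

lemma gaussian_monomial:
  fixes \<alpha> :: "nat \<Rightarrow> nat"
  shows integrable_gaussian_monomial:
      "integrable (lebesgue_Rd d) (\<lambda>x. (\<Prod>i<d. x i ^ \<alpha> i) * exp (- (\<Sum>i<d. (x i)\<^sup>2)))"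
    and integral_gaussian_monomial:
      "(LINT x|lebesgue_Rd d. (\<Prod>i<d. x i ^ \<alpha> i) * exp (- (\<Sum>i<d. (x i)\<^sup>2))) =
         pi powr (real d / 2) * (\<Prod>i<d. gauss_moment (\<alpha> i))"
proof -
  interpret product_sigma_finite "\<lambda>_::nat. lborel :: real measure"
    by standard
  have eq: "(\<lambda>x::nat \<Rightarrow> real. (\<Prod>i<d. x i ^ \<alpha> i) * exp (- (\<Sum>i<d. (x i)\<^sup>2))) =
      (\<lambda>x. \<Prod>i<d. x i ^ \<alpha> i * exp (- (x i)\<^sup>2))"
    by (simp add: prod.distrib exp_sum flip: sum_negf)
  have int: "integrable lborel (\<lambda>x::real. x ^ k * exp (- x\<^sup>2))" for k
    using has_bochner_integral_gauss_moment by (rule integrable.intros)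
  show "integrable (lebesgue_Rd d) (\<lambda>x. (\<Prod>i<d. x i ^ \<alpha> i) * exp (- (\<Sum>i<d. (x i)\<^sup>2)))"
    unfolding eq lebesgue_Rd_def by (rule product_integrable_prod) (auto intro: int)
  have "(LINT x|lebesgue_Rd d. (\<Prod>i<d. x i ^ \<alpha> i) * exp (- (\<Sum>i<d. (x i)\<^sup>2))) =
      (\<Prod>i<d. LINT x|lborel. x ^ \<alpha> i * exp (- x\<^sup>2))"
    unfolding eq lebesgue_Rd_def by (rule product_integral_prod) (auto intro: int)
  also have "\<dots> = (\<Prod>i<d. sqrt pi * gauss_moment (\<alpha> i))"
    by (intro prod.cong refl has_bochner_integral_integral_eq has_bochner_integral_gauss_moment)
  also have "\<dots> = sqrt pi ^ d * (\<Prod>i<d. gauss_moment (\<alpha> i))"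
    by (simp add: prod.distrib)
  also have "sqrt pi ^ d = pi powr (real d / 2)"
    by (simp add: powr_half_sqrt [symmetric] powr_powr flip: powr_realpow)
  finally show "(LINT x|lebesgue_Rd d. (\<Prod>i<d. x i ^ \<alpha> i) * exp (- (\<Sum>i<d. (x i)\<^sup>2))) =
      pi powr (real d / 2) * (\<Prod>i<d. gauss_moment (\<alpha> i))" .
qed

text \<open>Both sides of the design equation are linear in \<open>f\<close>, so monomials suffice;
  the normalising power of \<open>pi\<close> cancels.\<close>

lemma equi_weighted_gaussian_designI:
  assumes "finite X" "X \<noteq> {}" "X \<subseteq> Rd d"
    and moments: "\<And>\<alpha>. \<alpha> \<in> exponents_le t d \<Longrightarrow>
      (\<Sum>x\<in>X. \<Prod>i<d. x i ^ \<alpha> i) = real (card X) * (\<Prod>i<d. gauss_moment (\<alpha> i))"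
  shows "equi_weighted_gaussian_design t d X"
  unfolding equi_weighted_gaussian_design_def
proof (intro conjI ballI)
  fix f assume "f \<in> polys_le t d"
  then obtain c where f: "f = (\<lambda>x. \<Sum>\<alpha>\<in>exponents_le t d. c \<alpha> * (\<Prod>i<d. x i ^ \<alpha> i))"
    by (auto simp: polys_le_def)
  let ?m = "\<Sum>\<alpha>\<in>exponents_le t d. c \<alpha> * (\<Prod>i<d. gauss_moment (\<alpha> i))"
  have "(\<Sum>x\<in>X. f x) = (\<Sum>\<alpha>\<in>exponents_le t d. c \<alpha> * (\<Sum>x\<in>X. \<Prod>i<d. x i ^ \<alpha> i))"
    unfolding f by (subst sum.swap) (simp add: sum_distrib_left)
  also have "\<dots> = real (card X) * ?m"
    by (simp add: moments sum_distrib_left mult.left_commute)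
  finally have L: "(\<Sum>x\<in>X. f x) = real (card X) * ?m" .
  have "(LINT x|lebesgue_Rd d. f x * exp (- (\<Sum>i<d. (x i)\<^sup>2))) =
      (LINT x|lebesgue_Rd d. (\<Sum>\<alpha>\<in>exponents_le t d.
        c \<alpha> * ((\<Prod>i<d. x i ^ \<alpha> i) * exp (- (\<Sum>i<d. (x i)\<^sup>2)))))"
    unfolding f by (simp add: sum_distrib_right mult.assoc)
  also have "\<dots> = (\<Sum>\<alpha>\<in>exponents_le t d.
        c \<alpha> * (pi powr (real d / 2) * (\<Prod>i<d. gauss_moment (\<alpha> i))))"
    by (subst Bochner_Integration.integral_sum)
       (auto intro!: integrable_mult_right integrable_gaussian_monomial
             simp: integral_gaussian_monomial)
  also have "\<dots> = pi powr (real d / 2) * ?m"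
    by (simp add: sum_distrib_left mult.left_commute)
  finally show "1 / real (card X) * (\<Sum>x\<in>X. f x) = 1 / pi powr (real d / 2) *
      (LINT x|lebesgue_Rd d. f x * exp (- (\<Sum>i<d. (x i)\<^sup>2)))"
    using L assms(1,2) by simp
qed (use assms in auto)

section \<open>Sign vectors\<close>

text \<open>Such a set is coded by a triple over \<open>{..n}\<close> in which \<open>n\<close> is a
  padding symbol, deleted on decoding; hence the base \<open>n + 1\<close>.\<close>

lemma card_subsets_card_le_3:
  "finite {T. T \<subseteq> {..<n::nat} \<and> card T \<le> 3}" "card {T. T \<subseteq> {..<n::nat} \<and> card T \<le> 3} \<le> (n + 1) ^ 3"
proof -
  let ?F = "{T. T \<subseteq> {..<n::nat} \<and> card T \<le> 3}"
  let ?g = "\<lambda>(a, b, c). {a, b, c} - {n}"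
  have sub: "?F \<subseteq> ?g ` ({..n} \<times> {..n} \<times> {..n})"
  proof
    fix T assume T: "T \<in> ?F"
    then have fin: "finite T" by (auto intro: finite_subset)
    consider "card T = 0" | "card T = 1" | "card T = 2" | "card T = 3"
      using T by fastforce
    then obtain a b c where "T = {a, b, c} - {n}" "a \<le> n" "b \<le> n" "c \<le> n"
    proof cases
      case 1
      then have "T = {n, n, n} - {n}" using fin by simp
      then show ?thesis using that by blast
    next
      case 2
      then obtain a where a: "T = {a}" by (elim card_1_singletonE)
      then have "T = {a, a, a} - {n}" "a \<le> n" using T by auto
      then show ?thesis using that by blast
    next
      case 3
      then obtain a b where a: "T = {a, b}" by (auto simp: card_2_iff)
      then have "T = {a, b, b} - {n}" "a \<le> n" "b \<le> n" using T by auto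
      then show ?thesis using that by blast
    next
      case 4
      then obtain a b c where a: "T = {a, b, c}" by (auto simp: card_3_iff)
      then have "T = {a, b, c} - {n}" "a \<le> n" "b \<le> n" "c \<le> n" using T by auto
      then show ?thesis using that by blast
    qed
    then show "T \<in> ?g ` ({..n} \<times> {..n} \<times> {..n})"
      by (intro image_eqI[where x = "(a, b, c)"]) auto
  qed
  show "finite ?F" by (rule finite_subset[OF sub]) simp
  have "card ?F \<le> card (?g ` ({..n} \<times> {..n} \<times> {..n}))"
    by (rule card_mono[OF _ sub]) simp
  also have "\<dots> \<le> card ({..n} \<times> {..n} \<times> {..n})"
    by (rule card_image_le) simp
  also have "\<dots> = (n + 1) ^ 3"
    by (simp add: power3_eq_cube)
  finally show "card ?F \<le> (n + 1) ^ 3" .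
qed

lemma prod_signs:
  fixes f :: "'a \<Rightarrow> real"
  assumes "\<And>i. i \<in> A \<Longrightarrow> f i \<in> {-1, 1}"
  shows "prod f A \<in> {-1, 1}"
  using assms
proof (induction A rule: infinite_finite_induct)
  case (insert x A)
  then have "f x \<in> {-1, 1}" "prod f A \<in> {-1, 1}" by blast+
  then show ?case using insert.hyps by auto
qed auto

text \<open>\<open>G i\<close> is column \<open>i\<close> of a binary generator matrix with
  \<open>r\<close> rows, written multiplicatively. The second condition is linear independence over
  GF(2) of any four columns: no nonempty set of at most four of them multiplies to the all-ones
  column.\<close>

definition separating_signs :: "nat \<Rightarrow> nat \<Rightarrow> (nat \<Rightarrow> nat \<Rightarrow> real) \<Rightarrow> bool" where
  "separating_signs r n G \<longleftrightarrow> (\<forall>i k. G i k \<in> {-1, 1}) \<and>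
    (\<forall>S \<subseteq> {..<n}. S \<noteq> {} \<and> card S \<le> 4 \<longrightarrow> (\<exists>k<r. (\<Prod>i\<in>S. G i k) = -1))"

lemma separating_signsD:
  assumes "separating_signs r n G"
  shows "G i k \<in> {-1, 1}"
    and "S \<subseteq> {..<n} \<Longrightarrow> S \<noteq> {} \<Longrightarrow> card S \<le> 4 \<Longrightarrow> \<exists>k<r. (\<Prod>i\<in>S. G i k) = -1"
  using assms unfolding separating_signs_def by blast+

text \<open>A new column only has to avoid the products of at most three of the previous ones.\<close>

lemma greedy_sign_columns:
  assumes "d ^ 3 < 2 ^ r" "n \<le> d"
  shows "\<exists>G. separating_signs r n G"
  using assms(2)
proof (induction n)
  case 0
  show ?case by (intro exI[where x = "\<lambda>_ _. 1"]) (auto simp: separating_signs_def)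
next
  case (Suc n)
  then have "n \<le> d" by simp
  then obtain G where "separating_signs r n G" using Suc.IH by blast
  note G = separating_signsD(1)[OF this] and GS = separating_signsD(2)[OF this]
  let ?F = "{T. T \<subseteq> {..<n} \<and> card T \<le> 3}"
  \<comment> \<open>The forbidden columns. The empty \<open>T\<close> is among them and forbids the
    all-ones column.\<close>
  let ?B = "(\<lambda>T. restrict (\<lambda>k. \<Prod>i\<in>T. G i k) {..<r}) ` ?F"
  have "card ?B \<le> card ?F" by (rule card_image_le) (rule card_subsets_card_le_3)
  also have "\<dots> \<le> (n + 1) ^ 3" by (rule card_subsets_card_le_3)
  also have "\<dots> \<le> d ^ 3" using Suc.prems by (intro power_mono) auto
  also have "\<dots> < 2 ^ r" by (rule assms(1))
  also have "\<dots> = card ({..<r} \<rightarrow>\<^sub>E {-1, 1::real})" by (simp add: card_PiE numeral_2_eq_2)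
  finally have "card ?B < card ({..<r} \<rightarrow>\<^sub>E {-1, 1::real})" .
  moreover have "finite ?B" using card_subsets_card_le_3(1) by blast
  ultimately have "\<not> {..<r} \<rightarrow>\<^sub>E {-1, 1} \<subseteq> ?B"
    by (meson card_mono leD)
  then obtain c where c: "c \<in> {..<r} \<rightarrow>\<^sub>E {-1, 1}" "c \<notin> ?B" by blast
  \<comment> \<open>The value 1 beyond row \<open>r\<close> only keeps every entry a sign.\<close>
  define G' where "G' = (\<lambda>i k. if i = n then if k < r then c k else 1 else G i k)"
  have G': "G' i k \<in> {-1, 1}" for i k
    using G[of i k] c(1) by (auto simp: G'_def)
  have "\<exists>k<r. (\<Prod>i\<in>S. G' i k) = -1" if S: "S \<subseteq> {..<Suc n}" "S \<noteq> {}" "card S \<le> 4" for S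
  proof (cases "n \<in> S")
    case False
    then have Sn: "S \<subseteq> {..<n}" using S(1) by (auto simp: less_Suc_eq)
    have "(\<Prod>i\<in>S. G' i k) = (\<Prod>i\<in>S. G i k)" for k
      using False by (intro prod.cong) (auto simp: G'_def)
    then show ?thesis using GS[OF Sn] S by simp
  next
    case True
    define T where "T = S - {n}"
    have fin: "finite S" using S(1) by (auto intro: finite_subset)
    have T: "T \<in> ?F" using S True fin by (auto simp: T_def less_Suc_eq)
    have prod_S: "(\<Prod>i\<in>S. G' i k) = c k * (\<Prod>i\<in>T. G i k)" if "k < r" for k
    proof -
      have "(\<Prod>i\<in>S. G' i k) = G' n k * (\<Prod>i\<in>T. G' i k)"
        unfolding T_def by (rule prod.remove[OF fin True])
      also have "(\<Prod>i\<in>T. G' i k) = (\<Prod>i\<in>T. G i k)"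
        by (intro prod.cong) (auto simp: G'_def T_def)
      finally show ?thesis using that by (simp add: G'_def)
    qed
    have "c \<noteq> restrict (\<lambda>k. \<Prod>i\<in>T. G i k) {..<r}" using c(2) T by blast
    \<comment> \<open>Two signs that differ have product -1, so a row where \<open>c\<close> differs
      from the product over \<open>T\<close> separates \<open>S\<close>.\<close>
    then obtain k where k: "k < r" "c k \<noteq> (\<Prod>i\<in>T. G i k)"
      using c(1) by (auto simp: fun_eq_iff PiE_def extensional_def restrict_def split: if_splits)
    moreover have "c k \<in> {-1, 1}" using c(1) k(1) by auto
    moreover have "(\<Prod>i\<in>T. G i k) \<in> {-1, 1}" using G by (rule prod_signs)
    ultimately have "(\<Prod>i\<in>S. G' i k) = -1" by (auto simp: prod_S)
    then show ?thesis using k(1) by blast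
  qed
  then have "separating_signs r (Suc n) G'" using G' by (simp add: separating_signs_def)
  then show ?case by blast
qed

text \<open>For the least exponent with \<open>m < 2 ^ r\<close>, the preceding power is at most
  \<open>m\<close>; positivity of \<open>m\<close> ensures that there is a preceding one.\<close>

lemma ex_power_two_between:
  assumes "m > 0"
  shows "\<exists>r. m < 2 ^ r \<and> 2 ^ r \<le> 2 * (m::nat)"
proof -
  define r where "r = (LEAST r. m < 2 ^ r)"
  have r: "m < 2 ^ r" unfolding r_def by (rule LeastI[of _ m]) (rule less_exp)
  have "r \<noteq> 0" using r assms by (intro notI) simp
  then have "\<not> m < 2 ^ (r - 1)" unfolding r_def by (intro not_less_Least) (simp add: r_def)
  with r \<open>r \<noteq> 0\<close> show ?thesis by (intro exI[where x = r]) (cases r; simp)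
qed

text \<open>Multiplication by \<tau> is an involution of \<open>E\<close> that negates every
  summand, so the sum equals its own negative.\<close>

lemma sum_prod_eq_zero_by_twist:
  fixes E :: "('a \<Rightarrow> real) set"
  assumes \<tau>: "\<And>i. i \<in> I \<Longrightarrow> \<tau> i \<in> {-1, 1}"
    and E: "E \<subseteq> I \<rightarrow>\<^sub>E UNIV"
    and closed: "\<And>\<sigma>. \<sigma> \<in> E \<Longrightarrow> restrict (\<lambda>i. \<tau> i * \<sigma> i) I \<in> E"
    and S: "S \<subseteq> I" "prod \<tau> S = -1"
  shows "(\<Sum>\<sigma>\<in>E. \<Prod>i\<in>S. \<sigma> i) = 0"
proof -
  let ?t = "\<lambda>\<sigma>. restrict (\<lambda>i. \<tau> i * \<sigma> i) I"
  have inv: "?t (?t \<sigma>) = \<sigma>" if "\<sigma> \<in> E" for \<sigma>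
  proof -
    have "?t (?t \<sigma>) = restrict \<sigma> I" using \<tau> by (fastforce simp: restrict_def)
    also have "\<dots> = \<sigma>" using that E by (auto simp: PiE_def extensional_restrict)
    finally show ?thesis .
  qed
  have prod_t: "(\<Prod>i\<in>S. ?t \<sigma> i) = - (\<Prod>i\<in>S. \<sigma> i)" for \<sigma>
  proof -
    have "(\<Prod>i\<in>S. ?t \<sigma> i) = (\<Prod>i\<in>S. \<tau> i * \<sigma> i)" using S(1) by (intro prod.cong) auto
    then show ?thesis using S(2) by (simp add: prod.distrib)
  qed
  have "(\<Sum>\<sigma>\<in>E. \<Prod>i\<in>S. \<sigma> i) = (\<Sum>\<sigma>\<in>E. - (\<Prod>i\<in>S. \<sigma> i))"
    by (rule sum.reindex_bij_witness[of _ ?t ?t]) (simp_all only: inv closed prod_t minus_minus)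
  then show ?thesis by (simp add: sum_negf)
qed

text \<open>Odd sets, including those of size 5, are killed by the twist with -1. Even sets of size
  at most 5 have size at most 4, and a row of the separating matrix provides the twist. The bound is
  2 for the global sign times \<open>2 ^ r\<close>, which is at most
  \<open>2 * d ^ 3\<close>.\<close>

lemma exists_sign_design:
  assumes "d > 0"
  shows "\<exists>E. finite E \<and> E \<noteq> {} \<and> E \<subseteq> {..<d} \<rightarrow>\<^sub>E {-1, 1::real} \<and> card E \<le> 4 * d ^ 3 \<and>
    (\<forall>S \<subseteq> {..<d}. S \<noteq> {} \<and> card S \<le> 5 \<longrightarrow> (\<Sum>\<sigma>\<in>E. \<Prod>i\<in>S. \<sigma> i) = 0)"
proof -
  obtain r where r: "d ^ 3 < 2 ^ r" "2 ^ r \<le> 2 * d ^ 3"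
    using ex_power_two_between[of "d ^ 3"] assms by auto
  obtain G where "separating_signs r d G"
    using greedy_sign_columns[OF r(1) order_refl] by blast
  note G = separating_signsD(1)[OF this] and GS = separating_signsD(2)[OF this]
  \<comment> \<open>The codeword that multiplies the rows in \<open>v\<close> and the global sign
    \<open>s\<close>. Different pairs may give the same word; only an upper bound on
    \<open>card E\<close> is required.\<close>
  define word where "word = (\<lambda>(s, v). restrict (\<lambda>i. s * (\<Prod>k\<in>v. G i k)) {..<d})"
  define E where "E = word ` ({-1, 1} \<times> Pow {..<r})"
  have "card E \<le> card ({-1, 1::real} \<times> Pow {..<r})"
    unfolding E_def by (rule card_image_le) simp
  also have "\<dots> \<le> 4 * d ^ 3" using r(2) by (simp add: card_Pow card_cartesian_product)
  finally have cardE: "card E \<le> 4 * d ^ 3" .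
  have signs: "E \<subseteq> {..<d} \<rightarrow>\<^sub>E {-1, 1}"
  proof -
    have "word p \<in> {..<d} \<rightarrow>\<^sub>E {-1, 1}" if p: "p \<in> {-1, 1} \<times> Pow {..<r}" for p
    proof -
      have "fst p * (\<Prod>k\<in>snd p. G i k) \<in> {-1, 1}" for i
        using p prod_signs[of "snd p" "G i"] G by auto
      then show ?thesis
        unfolding word_def case_prod_unfold by (subst restrict_PiE_iff) blast
    qed
    then show ?thesis by (auto simp only: E_def)
  qed
  then have ext: "E \<subseteq> {..<d} \<rightarrow>\<^sub>E UNIV" by (auto simp: PiE_def)
  have "(\<Sum>\<sigma>\<in>E. \<Prod>i\<in>S. \<sigma> i) = 0" if S: "S \<subseteq> {..<d}" "S \<noteq> {}" "card S \<le> 5" for S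
  proof (cases "odd (card S)")
    case True
    show ?thesis
    proof (rule sum_prod_eq_zero_by_twist[where \<tau> = "\<lambda>_. -1", OF _ ext _ S(1)])
      fix \<sigma> assume "\<sigma> \<in> E"
      then obtain s v where \<sigma>: "\<sigma> = word (s, v)" "s \<in> {-1, 1}" "v \<subseteq> {..<r}"
        by (auto simp: E_def)
      have "restrict (\<lambda>i. - 1 * \<sigma> i) {..<d} = word (- s, v)"
        by (auto simp: \<sigma> word_def)
      then show "restrict (\<lambda>i. - 1 * \<sigma> i) {..<d} \<in> E"
        using \<sigma> unfolding E_def by (intro image_eqI[where x = "(- s, v)"]) auto
    qed (use True in auto)
  next
    case False
    then have "card S \<le> 4" using S(3) by (cases "card S = 5") auto
    then obtain k where k: "k < r" "(\<Prod>i\<in>S. G i k) = -1" using GS S by blast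
    show ?thesis
    proof (rule sum_prod_eq_zero_by_twist[where \<tau> = "\<lambda>i. G i k", OF G ext _ S(1) k(2)])
      fix \<sigma> assume "\<sigma> \<in> E"
      then obtain s v where \<sigma>: "\<sigma> = word (s, v)" "s \<in> {-1, 1}" "v \<subseteq> {..<r}"
        by (auto simp: E_def)
      have fin: "finite v" using \<sigma>(3) by (rule finite_subset) simp
      \<comment> \<open>The symmetric difference of \<open>v\<close> and \<open>{k}\<close>:
        multiplying by row \<open>k\<close> toggles it, since signs square to 1.\<close>
      define v' where "v' = (if k \<in> v then v - {k} else insert k v)"
      have "G i k * (\<Prod>k\<in>v. G i k) = (\<Prod>k\<in>v'. G i k)" for i
      proof (cases "k \<in> v")
        case True
        have "G i k * G i k = 1" using G[of i k] by auto
        then show ?thesis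
          using True fin by (simp add: v'_def prod.remove[OF fin True] flip: mult.assoc)
      qed (use fin in \<open>simp add: v'_def\<close>)
      then have "restrict (\<lambda>i. G i k * \<sigma> i) {..<d} = word (s, v')"
        by (auto simp: \<sigma> word_def mult.left_commute)
      then show "restrict (\<lambda>i. G i k * \<sigma> i) {..<d} \<in> E"
        using \<sigma> k(1) unfolding E_def
        by (intro image_eqI[where x = "(s, v')"]) (auto simp: v'_def)
    qed
  qed
  moreover have "finite E" "E \<noteq> {}" by (auto simp: E_def)
  ultimately show ?thesis using signs cardE by blast
qed

section \<open>A simplex in the positive orthant\<close>

text \<open>The actual edge length, \<open>sqrt (real d + 1)\<close>, divided by
  \<open>sqrt 2\<close>. The scale comes from the variance 1/2 of a squared Gaussian coordinate,
  which forces circumradius \<open>sqrt (real d / 2)\<close>.\<close>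

definition simplex_edge :: "nat \<Rightarrow> real" where
  "simplex_edge d = sqrt ((real d + 1) / 2)"

text \<open>The solution \<open>b\<close> of
  \<open>d * b + simplex_edge d + (1 / 2 + 1 / sqrt 2) = (d + 1) / 2\<close>, which puts the
  centroid at 1/2 in every coordinate.\<close>

definition simplex_base :: "nat \<Rightarrow> real" where
  "simplex_base d = 1 / 2 - (simplex_edge d + 1 / sqrt 2) / real d"

text \<open>Invariance under permutations of the coordinates determines the simplex up to the signs of the
  two square roots; this choice puts it in the positive orthant.\<close>

definition simplex_vertex :: "nat \<Rightarrow> nat \<Rightarrow> nat \<Rightarrow> real" where
  "simplex_vertex d j i =
     (if j = d then 1 / 2 + 1 / sqrt 2 else simplex_base d + (if j = i then simplex_edge d else 0))"

lemma simplex_edge_pos: "simplex_edge d > 0"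
  by (simp add: simplex_edge_def)

text \<open>Positivity means \<open>simplex_edge d + s < d / 2\<close> with
  \<open>s = 1 / sqrt 2\<close>. Squaring turns this into \<open>s < d / 4 - 1 / 2\<close>, which at
  \<open>d = 5\<close> reads \<open>s < 3 / 4\<close> and already fails at
  \<open>d = 4\<close>.\<close>

lemma simplex_base_pos:
  assumes "d \<ge> 5"
  shows "simplex_base d > 0"
proof -
  define s :: real where "s = 1 / sqrt 2"
  have s2: "s\<^sup>2 = 1 / 2" by (simp add: s_def power_divide)
  have d: "real d \<ge> 5" using assms by simp
  have "s < 3 / 4" by (rule power2_less_imp_less) (auto simp: s2 power_divide)
  then have "real d * s < real d * (real d / 4 - 1 / 2)"
    using d by (intro mult_strict_left_mono) auto
  moreover have "(real d / 2 - s)\<^sup>2 = real d * (real d / 4 - 1 / 2) - real d * s + (real d + 1) / 2"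
    using s2 by (simp add: power2_eq_square field_simps)
  ultimately have "(real d + 1) / 2 < (real d / 2 - s)\<^sup>2" by linarith
  then have "simplex_edge d < real d / 2 - s"
    unfolding simplex_edge_def using d \<open>s < 3 / 4\<close> by (intro real_less_lsqrt) auto
  then show ?thesis
    using d unfolding simplex_base_def s_def[symmetric] by (simp add: field_simps)
qed

lemma simplex_vertex_pos: "d \<ge> 5 \<Longrightarrow> simplex_vertex d j i > 0"
  using simplex_base_pos[of d] simplex_edge_pos[of d]
  by (auto simp: simplex_vertex_def add_pos_pos)

lemma simplex_vertex_inj:
  assumes "d \<ge> 2" "j \<le> d" "j' \<le> d" "\<And>i. i < d \<Longrightarrow> simplex_vertex d j i = simplex_vertex d j' i"
  shows "j = j'"
proof (rule ccontr)
  have less: False if "k < k'" "k' \<le> d"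
    "\<And>i. i < d \<Longrightarrow> simplex_vertex d k i = simplex_vertex d k' i" for k k'
  proof -
    show False
    proof (cases "k' = d")
      case True
      \<comment> \<open>Vertex \<open>d\<close> has all coordinates equal, so a second coordinate is
        needed to tell it from vertex \<open>k\<close>; this is where \<open>d \<ge> 2\<close>
        enters.\<close>
      have "(if k = 0 then 1 else 0) < d" "(if k = 0 then 1 else 0) \<noteq> k" using assms(1) by auto
      then obtain i where "i < d" "i \<noteq> k" by blast
      then show False
        using that(3)[of i] that(3)[of k] True that(1) simplex_edge_pos[of d]
        by (simp add: simplex_vertex_def)
    next
      case False
      then show False
        using that(3)[of k] that(1,2) simplex_edge_pos[of d] by (simp add: simplex_vertex_def)
    qed
  qed
  assume "j \<noteq> j'"
  then show False using less[of j j'] less[of j' j] assms by (metis linorder_neqE_nat)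
qed

text \<open>The average over the \<open>d + 1\<close> vertices is 1/2, the Gaussian mean of a
  squared coordinate.\<close>

lemma sum_simplex_vertex:
  assumes "i < d"
  shows "(\<Sum>j\<le>d. simplex_vertex d j i) = (real d + 1) / 2"
proof -
  have "(\<Sum>j<d. simplex_vertex d j i) = real d * simplex_base d + simplex_edge d"
    using assms by (simp add: simplex_vertex_def sum.distrib)
  also have "\<dots> = real d / 2 - 1 / sqrt 2"
    using assms by (simp add: simplex_base_def field_simps)
  finally show ?thesis
    by (simp add: simplex_vertex_def add_divide_distrib flip: lessThan_Suc_atMost)
qed

text \<open>On average this is 1/4 off the diagonal and 3/4 on it, matching the Gaussian means of
  \<open>(x i)\<^sup>2 * (x k)\<^sup>2\<close> and \<open>x i ^ 4\<close>.\<close>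

lemma sum_simplex_vertex_mult:
  assumes "i < d" "k < d"
  shows "(\<Sum>j\<le>d. simplex_vertex d j i * simplex_vertex d j k) =
    (real d + 1) / 4 + (if i = k then (real d + 1) / 2 else 0)"
proof -
  define s where "s = 1 / sqrt 2"
  define w where "w = simplex_edge d"
  define b where "b = simplex_base d"
  \<comment> \<open>Naming the reciprocal makes the identity below polynomial, modulo the relations
    for \<open>s * s\<close>, \<open>w * w\<close> and \<open>real d * v\<close>.\<close>
  define v where "v = 1 / real d"
  have s2: "s * s = 1 / 2" by (simp add: s_def)
  have w2: "w * w = (real d + 1) / 2" by (simp add: w_def simplex_edge_def)
  have v: "real d * v = 1" using assms by (simp add: v_def)
  have b: "b = 1 / 2 - (w + s) * v" by (simp add: b_def simplex_base_def w_def s_def v_def)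
  have "(\<Sum>j<d. simplex_vertex d j i * simplex_vertex d j k) =
      (\<Sum>j<d. b * b + (if j = i then b * w else 0) + (if j = k then b * w else 0)
        + (if j = i then if i = k then w * w else 0 else 0))"
    by (intro sum.cong) (auto simp: simplex_vertex_def b_def w_def algebra_simps)
  also have "\<dots> = real d * (b * b) + 2 * (b * w) + (if i = k then w * w else 0)"
    using assms by (simp add: sum.distrib)
  \<comment> \<open>The subtracted square is exactly what vertex \<open>d\<close> contributes when
    it is added back.\<close>
  also have "real d * (b * b) + 2 * (b * w) = (real d + 1) / 4 - (1 / 2 + s)\<^sup>2"
    using s2 w2 v unfolding b power2_eq_square by algebra
  finally show ?thesis
    by (simp add: w2 simplex_vertex_def power2_eq_square s_def flip: lessThan_Suc_atMost)
qed

text \<open>In degree at most 2 only 1, \<open>y i\<close>, \<open>(y i)\<^sup>2\<close> and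
  \<open>y i * y k\<close> occur, and the two moment computations above settle each of them.\<close>

lemma sum_prod_simplex_vertex_power:
  assumes "(\<Sum>i<d. \<beta> i) \<le> 2"
  shows "(\<Sum>j\<le>d. \<Prod>i<d. simplex_vertex d j i ^ \<beta> i) =
    (real d + 1) * (\<Prod>i<d. gauss_moment (2 * \<beta> i))"
proof (cases "\<forall>i<d. \<beta> i = 0")
  case True
  then show ?thesis by simp
next
  case False
  then obtain i where i: "i < d" "\<beta> i \<noteq> 0" by blast
  let ?I = "{..<d} - {i}"
  have sum_i: "\<beta> i + (\<Sum>i\<in>?I. \<beta> i) \<le> 2"
    using assms sum.remove[of "{..<d}" i \<beta>] i by simp
  have prod_i: "(\<Prod>i<d. f i) = f i * (\<Prod>i\<in>?I. f i)" for f :: "nat \<Rightarrow> real"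
    using i by (intro prod.remove) auto
  show ?thesis
  proof (cases "\<forall>k\<in>?I. \<beta> k = 0")
    case True
    then consider "\<beta> i = 1" | "\<beta> i = 2" using sum_i i(2) by fastforce
    then show ?thesis
    proof cases
      case 1
      then show ?thesis using True i by (simp add: prod_i sum_simplex_vertex)
    next
      case 2
      then show ?thesis
        using True i sum_simplex_vertex_mult[of i d i]
        by (simp add: prod_i power2_eq_square)
    qed
  next
    case False
    then obtain k where k: "k \<in> ?I" "\<beta> k \<noteq> 0" by blast
    let ?J = "?I - {k}"
    have sum_k: "\<beta> i + (\<beta> k + (\<Sum>i\<in>?J. \<beta> i)) \<le> 2"
      using sum_i sum.remove[of ?I k \<beta>] k by simp
    have prod_k: "(\<Prod>i\<in>?I. f i) = f k * (\<Prod>i\<in>?J. f i)" for f :: "nat \<Rightarrow> real"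
      using k by (intro prod.remove) auto
    have "\<beta> i = 1" "\<beta> k = 1" "(\<Sum>i\<in>?J. \<beta> i) = 0" using sum_k i k by linarith+
    moreover from this(3) have "\<forall>l\<in>?J. \<beta> l = 0" by simp
    ultimately show ?thesis
      using i k sum_simplex_vertex_mult[of i d k] by (simp add: prod_i prod_k)
  qed
qed

section \<open>The design\<close>

definition sign_radius_point :: "nat \<Rightarrow> (nat \<Rightarrow> real) \<times> nat \<Rightarrow> nat \<Rightarrow> real" where
  "sign_radius_point d = (\<lambda>(\<sigma>, j). restrict (\<lambda>i. \<sigma> i * sqrt (simplex_vertex d j i)) {..<d})"

text \<open>A design averages over a set, so coinciding points would be counted once. Since all
  radii are positive, each coordinate reveals its sign and its radius.\<close>

lemma inj_on_sign_radius_point: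
  assumes "d \<ge> 5"
  shows "inj_on (sign_radius_point d) (({..<d} \<rightarrow>\<^sub>E {-1, 1}) \<times> {..d})"
proof (rule inj_onI, clarify)
  fix \<sigma> \<sigma>' :: "nat \<Rightarrow> real" and j j'
  assume \<sigma>: "\<sigma> \<in> {..<d} \<rightarrow>\<^sub>E {-1, 1}" and \<sigma>': "\<sigma>' \<in> {..<d} \<rightarrow>\<^sub>E {-1, 1}"
    and j: "j \<le> d" "j' \<le> d"
    and eq: "sign_radius_point d (\<sigma>, j) = sign_radius_point d (\<sigma>', j')"
  have sign_mult_eq: "s = s' \<and> a = b"
    if "s * a = s' * b" "a > 0" "b > 0" "s \<in> {-1, 1}" "s' \<in> {-1, 1}" for s s' a b :: real
    using that by auto
  have *: "\<sigma> i = \<sigma>' i \<and> simplex_vertex d j i = simplex_vertex d j' i" if "i < d" for i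
  proof -
    have "sqrt (simplex_vertex d j i) > 0" "sqrt (simplex_vertex d j' i) > 0"
      using simplex_vertex_pos[OF assms] by simp_all
    moreover have "\<sigma> i * sqrt (simplex_vertex d j i) = \<sigma>' i * sqrt (simplex_vertex d j' i)"
      using fun_cong[OF eq, of i] that by (simp add: sign_radius_point_def)
    moreover have "\<sigma> i \<in> {-1, 1}" "\<sigma>' i \<in> {-1, 1}" using \<sigma> \<sigma>' that by auto
    ultimately show ?thesis using sign_mult_eq by (metis real_sqrt_eq_iff)
  qed
  have "\<sigma> = \<sigma>'" using \<sigma> \<sigma>' * by (intro PiE_ext) auto
  moreover have "j = j'" using simplex_vertex_inj[of d j j'] assms j * by auto
  ultimately show "\<sigma> = \<sigma>' \<and> j = j'" by blast
qed

text \<open>On signs only the parity of an exponent matters, so the monomial becomes the product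
  over the odd positions. Each of these has exponent at least 1, so there are at most
  \<open>t\<close> of them.\<close>

lemma sum_sign_monomial_eq_zero:
  fixes d :: nat
  assumes E: "E \<subseteq> {..<d} \<rightarrow>\<^sub>E {-1, 1::real}"
    and vanish: "\<And>S. S \<subseteq> {..<d} \<Longrightarrow> S \<noteq> {} \<Longrightarrow> card S \<le> t \<Longrightarrow> (\<Sum>\<sigma>\<in>E. \<Prod>i\<in>S. \<sigma> i) = 0"
    and \<alpha>: "(\<Sum>i<d. \<alpha> i) \<le> t" and odd: "i < d" "odd (\<alpha> i)"
  shows "(\<Sum>\<sigma>\<in>E. \<Prod>i<d. \<sigma> i ^ \<alpha> i) = 0"
proof -
  define S where "S = {i \<in> {..<d}. odd (\<alpha> i)}"
  have "card S = (\<Sum>i\<in>S. 1)" by simp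
  also have "\<dots> \<le> (\<Sum>i\<in>S. \<alpha> i)" by (intro sum_mono) (auto simp: S_def odd_pos Suc_leI)
  also have "\<dots> \<le> (\<Sum>i<d. \<alpha> i)" by (intro sum_mono2) (auto simp: S_def)
  finally have "card S \<le> t" using \<alpha> by simp
  moreover have "S \<subseteq> {..<d}" "S \<noteq> {}" using odd by (auto simp: S_def)
  moreover have "(\<Prod>i<d. \<sigma> i ^ \<alpha> i) = (\<Prod>i\<in>S. \<sigma> i)" if "\<sigma> \<in> E" for \<sigma>
  proof -
    have "\<sigma> i ^ \<alpha> i = (if odd (\<alpha> i) then \<sigma> i else 1)" if "i < d" for i
    proof -
      have "\<sigma> i \<in> {-1, 1}" using E \<open>\<sigma> \<in> E\<close> that by auto
      then show ?thesis by auto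
    qed
    then have "(\<Prod>i<d. \<sigma> i ^ \<alpha> i) = (\<Prod>i<d. if odd (\<alpha> i) then \<sigma> i else 1)"
      by (intro prod.cong) auto
    then show ?thesis unfolding S_def by (subst prod.inter_filter) auto
  qed
  ultimately show ?thesis using vanish by simp
qed

theorem theorem4p7:
  "\<exists>C::real. C > 0 \<and>
     (\<forall>d::nat. d \<ge> 5 \<longrightarrow>
        (\<exists>X :: (nat \<Rightarrow> real) set.
           real (card X) \<le> C * real d ^ 4 \<and> equi_weighted_gaussian_design 5 d X))"
\<comment> \<open>The 8 is the factor 4 from the sign design times 2 from
  \<open>d + 1 \<le> 2 * d\<close>.\<close>
proof (intro exI[where x = 8] conjI allI impI)
  fix d :: nat
  assume d: "d \<ge> 5"
  then have "d > 0" by simp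
  then obtain E where E: "finite E" "E \<noteq> {}" "E \<subseteq> {..<d} \<rightarrow>\<^sub>E {-1, 1::real}"
    "card E \<le> 4 * d ^ 3"
    and vanish: "\<And>S. S \<subseteq> {..<d} \<Longrightarrow> S \<noteq> {} \<Longrightarrow> card S \<le> 5 \<Longrightarrow> (\<Sum>\<sigma>\<in>E. \<Prod>i\<in>S. \<sigma> i) = 0"
    using exists_sign_design[of d] by blast
  define X where "X = sign_radius_point d ` (E \<times> {..d})"
  have inj: "inj_on (sign_radius_point d) (E \<times> {..d})"
    by (rule inj_on_subset[OF inj_on_sign_radius_point[OF d]]) (use E(3) in auto)
  have cardX: "card X = card E * (d + 1)"
    by (simp add: X_def card_image[OF inj] card_cartesian_product)
  also have "\<dots> \<le> 4 * d ^ 3 * (2 * d)" using E(4) d by (intro mult_mono) auto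
  also have "\<dots> = 8 * d ^ 4" by (simp add: power4_eq_xxxx power3_eq_cube)
  finally have "real (card X) \<le> real (8 * d ^ 4)" by (rule of_nat_mono)
  then have bound: "real (card X) \<le> 8 * real d ^ 4" by simp
  have "equi_weighted_gaussian_design 5 d X"
  proof (rule equi_weighted_gaussian_designI)
    show "finite X" "X \<noteq> {}" using E by (auto simp: X_def)
    show "X \<subseteq> Rd d" by (auto simp: X_def Rd_def sign_radius_point_def split: if_splits)
    fix \<alpha> assume "\<alpha> \<in> exponents_le 5 d"
    then have \<alpha>: "(\<Sum>i<d. \<alpha> i) \<le> 5" by (simp add: exponents_le_def)
    have "(\<Sum>x\<in>X. \<Prod>i<d. x i ^ \<alpha> i) =
        (\<Sum>\<sigma>\<in>E. \<Sum>j\<le>d. \<Prod>i<d. (\<sigma> i * sqrt (simplex_vertex d j i)) ^ \<alpha> i)"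
      unfolding X_def by (subst sum.reindex[OF inj]) (simp add: sum.cartesian_product
          sign_radius_point_def case_prod_unfold)
    \<comment> \<open>Signs and radii range independently, so the monomial sum splits into a sign
      factor and a radius factor.\<close>
    also have "\<dots> = (\<Sum>\<sigma>\<in>E. \<Prod>i<d. \<sigma> i ^ \<alpha> i) *
        (\<Sum>j\<le>d. \<Prod>i<d. sqrt (simplex_vertex d j i) ^ \<alpha> i)"
      by (simp add: power_mult_distrib prod.distrib sum_product)
    also have "\<dots> = real (card X) * (\<Prod>i<d. gauss_moment (\<alpha> i))"
    proof (cases "\<exists>i<d. odd (\<alpha> i)")
      case True
      then obtain i where i: "i < d" "odd (\<alpha> i)" by blast
      have "(\<Sum>\<sigma>\<in>E. \<Prod>i<d. \<sigma> i ^ \<alpha> i) = 0"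
        by (rule sum_sign_monomial_eq_zero[OF E(3) vanish \<alpha> i])
      moreover have "gauss_moment (\<alpha> i) = 0" using i by (simp add: gauss_moment_def)
      then have "(\<Prod>i<d. gauss_moment (\<alpha> i)) = 0" using i by (intro prod_zero) auto
      ultimately show ?thesis by simp
    next
      case False
      define \<beta> where "\<beta> i = \<alpha> i div 2" for i
      have \<beta>: "\<alpha> i = 2 * \<beta> i" if "i < d" for i using False that by (simp add: \<beta>_def)
      then have "(\<Sum>i<d. \<alpha> i) = 2 * (\<Sum>i<d. \<beta> i)" by (simp add: sum_distrib_left)
      \<comment> \<open>All exponents are even, so total degree at most 5 leaves degree at most 2 in
        the squared coordinates.\<close>
      then have sum_\<beta>: "(\<Sum>i<d. \<beta> i) \<le> 2" using \<alpha> by simp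
      have "(\<Prod>i<d. \<sigma> i ^ \<alpha> i) = 1" if "\<sigma> \<in> E" for \<sigma>
      proof (rule prod.neutral, rule ballI)
        fix i assume i: "i \<in> {..<d}"
        then have "\<sigma> i \<in> {-1, 1}" using E(3) that by auto
        then show "\<sigma> i ^ \<alpha> i = 1" using i False by auto
      qed
      then have "(\<Sum>\<sigma>\<in>E. \<Prod>i<d. \<sigma> i ^ \<alpha> i) = real (card E)" by simp
      moreover have "(\<Sum>j\<le>d. \<Prod>i<d. sqrt (simplex_vertex d j i) ^ \<alpha> i) =
          (\<Sum>j\<le>d. \<Prod>i<d. simplex_vertex d j i ^ \<beta> i)"
        using simplex_vertex_pos[OF d]
        by (intro sum.cong prod.cong) (auto simp: \<beta> power_mult less_imp_le)
      moreover have "(\<Prod>i<d. gauss_moment (\<alpha> i)) = (\<Prod>i<d. gauss_moment (2 * \<beta> i))"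
        by (simp add: \<beta>)
      ultimately show ?thesis
        by (simp add: sum_prod_simplex_vertex_power[OF sum_\<beta>] cardX algebra_simps)
    qed
    finally show "(\<Sum>x\<in>X. \<Prod>i<d. x i ^ \<alpha> i) = real (card X) * (\<Prod>i<d. gauss_moment (\<alpha> i))" .
  qed
  with bound show "\<exists>X. real (card X) \<le> 8 * real d ^ 4 \<and> equi_weighted_gaussian_design 5 d X"
    by blast
qed simp

end
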